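(* Let $\mathbf B\in\mathbb C^{M\times M}$ be a Hermitian (possibly indefinite) matrix, and consider the generalized downlink beamforming (GDB) problem $$\min_{\mathbf V_1,\dots,\mathbf V_K\succeq 0}\ \operatorname{tr}\Big(\mathbf B\sum_{k=1}^K\mathbf V_k\Big)\quad\text{s.t.}\quad \Big(1+\tfrac1{\gamma_k}\Big)\mathbf h_k^{H}\mathbf V_k\mathbf h_k\ \ge\ \sum_{j=1}^K\mathbf h_k^{H}\mathbf V_j\mathbf h_k+\sigma_k^2,\quad k=1,\dots,K,$$ and its Lagrangian dual $$\max_{\beta\in\mathbb R^K,\ \beta\ge 0}\ \sum_{k=1}^K\beta_k\sigma_k^2\quad\text{s.t.}\quad \mathbf C(\beta)\succeq \frac{\beta_k(\gamma_k+1)}{\gamma_k}\mathbf h_k\mathbf h_k^{H},\quad k=1,\dots,K,$$ with $\mathbf C(\beta)=\mathbf B+\sum_{j=1}^K\beta_j\mathbf h_j\mathbf h_j^{H}$. Let $I(\cdot)$, $\mathcal F_1$ and $\mathcal F$ be as defined in the context. Then: (a) If the dual problem is feasible, then it admits a unique optimal solution $\beta^\star$, and $\beta^\star\ge\beta$ (component-wise) for all $\beta\in\mathcal F$. (b) The optimal solution $\beta^\star$ of the dual problem is a fixed point of $I(\cdot)$, i.e. $\beta^\star=I(\beta^\star)$. (c) The GDB problem is bounded if and only if there exists $\beta\in\mathcal F_1$ such that $\beta=I(\beta)$.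
   Context: Data: integers $K,M\ge1$; vectors $\mathbf h_1,\dots,\mathbf h_K\in\mathbb C^M$; scalars $\gamma_k>0$ and $\sigma_k^2>0$ for $k=1,\dots,K$. All matrices $\mathbf V_k$ are Hermitian $M\times M$. In the source, $\mathbf B=\mathbf I-2\sum_q\lambda_q\mathbf M_q$ for a fixed real vector $(\lambda_q)$ and fixed Hermitian matrices $\mathbf M_q$. "Bounded" means that the objective of the (minimization) GDB problem is bounded below on its feasible set, i.e. its optimal value is not $-\infty$. Interference function: $I(\beta)=[I_1(\beta),\dots,I_K(\beta)]^{T}$ with $$I_k(\beta)=\frac{\gamma_k}{\gamma_k+1}\,\frac{1}{\mathbf h_k^{H}\mathbf C(\beta)^{-1}\mathbf h_k},$$ where for singular $\mathbf C(\beta)\succeq 0$ having all $\mathbf h_k$ in its range, the inverse is read as the Moore–Penrose pseudoinverse. $\mathcal F_1=\{\beta\in\mathbb R^K:\ \beta\ge0,\ \mathbf C(\beta)\succeq0,\ \mathbf h_1,\dots,\mathbf h_K\in\operatorname{range}\mathbf C(\beta)\}$, and $\mathcal F=\mathcal F_1\cap\{\beta:\beta\le I(\beta)\}$. The source uses $\mathcal F$ as the feasible region of an equivalent reformulation of the dual problem. Vector inequalities are component-wise.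
   Formalization: Added: the GDB constraints are feasible; in (c), every dual optimal solution lies in F_1. The claim fails without these. Where h_k is not in range C(β), I_k(β), undefined in the source, is set to 0. *)

theory Defs
  imports "HOL-Analysis.Analysis"
begin

section \<open>Complex matrices\<close>

definition cinner :: "complex ^ 'n \<Rightarrow> complex ^ 'n \<Rightarrow> complex" where
  "cinner x y = (\<Sum>i\<in>UNIV. cnj (x $ i) * y $ i)"

definition conj_transpose :: "complex ^ 'n ^ 'm \<Rightarrow> complex ^ 'm ^ 'n" where
  "conj_transpose A = (\<chi> i j. cnj (A $ j $ i))"

definition hermitian :: "complex ^ 'n ^ 'n \<Rightarrow> bool" where
  "hermitian A \<longleftrightarrow> conj_transpose A = A"

(* For Hermitian A the number cinner x (A *v x) is real, so taking Re loses nothing. *)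
definition psd :: "complex ^ 'n ^ 'n \<Rightarrow> bool" where
  "psd A \<longleftrightarrow> hermitian A \<and> (\<forall>x. 0 \<le> Re (cinner x (A *v x)))"

definition loewner_ge :: "complex ^ 'n ^ 'n \<Rightarrow> complex ^ 'n ^ 'n \<Rightarrow> bool" (infix \<open>\<succeq>\<close> 50) where
  "A \<succeq> A' \<longleftrightarrow> psd (A - A')"

definition outer :: "complex ^ 'n \<Rightarrow> complex ^ 'n ^ 'n" where
  "outer x = (\<chi> i j. x $ i * cnj (x $ j))"

definition mat_range :: "complex ^ 'n ^ 'm \<Rightarrow> (complex ^ 'm) set" where
  "mat_range A = range (\<lambda>x. A *v x)"

definition penrose :: "complex ^ 'n ^ 'm \<Rightarrow> complex ^ 'm ^ 'n \<Rightarrow> bool" where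
  "penrose A X \<longleftrightarrow> A ** X ** A = A \<and> X ** A ** X = X \<and>
     hermitian (A ** X) \<and> hermitian (X ** A)"

definition pinv :: "complex ^ 'n ^ 'm \<Rightarrow> complex ^ 'm ^ 'n" where
  "pinv A = (THE X. penrose A X)"

lemma conj_transpose_mult: "conj_transpose (A ** B) = conj_transpose B ** conj_transpose A"
  by (simp add: conj_transpose_def matrix_matrix_mult_def vec_eq_iff mult.commute)

lemma penrose_unique:
  assumes X: "penrose A X" and Y: "penrose A Y"
  shows "X = Y"
proof -
  have left: "A ** X = A ** Y"
  proof -
    have "A ** X = conj_transpose ((A ** Y) ** (A ** X))"
      using X Y by (metis penrose_def hermitian_def matrix_mul_assoc)
    also have "\<dots> = (A ** X) ** (A ** Y)"
      using X Y by (simp add: conj_transpose_mult penrose_def hermitian_def)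
    also have "\<dots> = A ** Y"
      using X by (metis penrose_def matrix_mul_assoc)
    finally show ?thesis .
  qed
  have right: "X ** A = Y ** A"
  proof -
    have "X ** A = conj_transpose ((X ** A) ** (Y ** A))"
      using X Y by (metis penrose_def hermitian_def matrix_mul_assoc)
    also have "\<dots> = (Y ** A) ** (X ** A)"
      using X Y by (simp add: conj_transpose_mult penrose_def hermitian_def)
    also have "\<dots> = Y ** A"
      using X by (metis penrose_def matrix_mul_assoc)
    finally show ?thesis .
  qed
  show ?thesis
    using X Y left right by (metis penrose_def matrix_mul_assoc)
qed

lemma pinv_invertible:
  fixes A :: "complex ^ 'n ^ 'n"
  assumes "invertible A"
  shows "pinv A = matrix_inv A"
proof -
  have inv: "A ** matrix_inv A = mat 1" "matrix_inv A ** A = mat 1"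
    using assms someI_ex[of "\<lambda>X. A ** X = mat 1 \<and> X ** A = mat 1"]
    unfolding invertible_def matrix_inv_def by auto
  have "hermitian (mat 1 :: complex ^ 'n ^ 'n)"
    by (simp add: hermitian_def conj_transpose_def mat_def vec_eq_iff)
  with inv have "penrose A (matrix_inv A)"
    by (simp add: penrose_def)
  then show ?thesis
    unfolding pinv_def by (blast intro: the_equality penrose_unique)
qed


section \<open>The beamforming problem and its dual\<close>

(* Throughout, s2 k stands for the noise power sigma_k^2. *)

definition gdb_feasible ::
  "('k::finite \<Rightarrow> complex ^ 'm) \<Rightarrow> ('k \<Rightarrow> real) \<Rightarrow> ('k \<Rightarrow> real) \<Rightarrow> ('k \<Rightarrow> complex ^ 'm ^ 'm) set" where
  "gdb_feasible h \<gamma> s2 = {V. (\<forall>k. psd (V k)) \<and>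
     (\<forall>k. (1 + 1 / \<gamma> k) * Re (cinner (h k) (V k *v h k))
          \<ge> (\<Sum>j\<in>UNIV. Re (cinner (h k) (V j *v h k))) + s2 k)}"

definition gdb_objective ::
  "complex ^ 'm ^ 'm \<Rightarrow> ('k::finite \<Rightarrow> complex ^ 'm ^ 'm) \<Rightarrow> real" where
  "gdb_objective B V = Re (trace (B ** (\<Sum>k\<in>UNIV. V k)))"

definition gdb_bounded ::
  "complex ^ 'm ^ 'm \<Rightarrow> ('k::finite \<Rightarrow> complex ^ 'm) \<Rightarrow> ('k \<Rightarrow> real) \<Rightarrow> ('k \<Rightarrow> real) \<Rightarrow> bool" where
  "gdb_bounded B h \<gamma> s2 \<longleftrightarrow> bdd_below (gdb_objective B ` gdb_feasible h \<gamma> s2)"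

definition C_mat ::
  "complex ^ 'm ^ 'm \<Rightarrow> ('k::finite \<Rightarrow> complex ^ 'm) \<Rightarrow> real ^ 'k \<Rightarrow> complex ^ 'm ^ 'm" where
  "C_mat B h \<beta> = B + (\<Sum>j\<in>UNIV. (\<beta> $ j) *\<^sub>R outer (h j))"

definition dual_feasible ::
  "complex ^ 'm ^ 'm \<Rightarrow> ('k::finite \<Rightarrow> complex ^ 'm) \<Rightarrow> ('k \<Rightarrow> real) \<Rightarrow> (real ^ 'k) set" where
  "dual_feasible B h \<gamma> = {\<beta>. 0 \<le> \<beta> \<and>
     (\<forall>k. C_mat B h \<beta> \<succeq> (\<beta> $ k * (\<gamma> k + 1) / \<gamma> k) *\<^sub>R outer (h k))}"

definition dual_optimal ::
  "complex ^ 'm ^ 'm \<Rightarrow> ('k::finite \<Rightarrow> complex ^ 'm) \<Rightarrow> ('k \<Rightarrow> real) \<Rightarrow> ('k \<Rightarrow> real) \<Rightarrow> real ^ 'k \<Rightarrow> bool" where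
  "dual_optimal B h \<gamma> s2 \<beta> \<longleftrightarrow>
     is_arg_max (\<lambda>b. \<Sum>k\<in>UNIV. b $ k * s2 k) (\<lambda>b. b \<in> dual_feasible B h \<gamma>) \<beta>"


section \<open>Interference function\<close>

(* When h k is not in the range of C = C_mat B h \<beta>, the inverse in
   h_k^H C^{-1} h_k has no meaning.  For C psd the form h_k^H (C + e I)^{-1} h_k
   then tends to infinity as e tends to 0 from above, so its reciprocal tends
   to 0; this limit is the value used outside the range condition.  Under the
   range condition it plays no role.  The form is real since C is Hermitian. *)
definition interference ::
  "complex ^ 'm ^ 'm \<Rightarrow> ('k::finite \<Rightarrow> complex ^ 'm) \<Rightarrow> ('k \<Rightarrow> real) \<Rightarrow> real ^ 'k \<Rightarrow> real ^ 'k" where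
  "interference B h \<gamma> \<beta> = (\<chi> k.
     if h k \<in> mat_range (C_mat B h \<beta>)
     then \<gamma> k / (\<gamma> k + 1) * (1 / Re (cinner (h k) (pinv (C_mat B h \<beta>) *v h k)))
     else 0)"

definition F1 ::
  "complex ^ 'm ^ 'm \<Rightarrow> ('k::finite \<Rightarrow> complex ^ 'm) \<Rightarrow> (real ^ 'k) set" where
  "F1 B h = {\<beta>. 0 \<le> \<beta> \<and> psd (C_mat B h \<beta>) \<and> (\<forall>k. h k \<in> mat_range (C_mat B h \<beta>))}"

definition F ::
  "complex ^ 'm ^ 'm \<Rightarrow> ('k::finite \<Rightarrow> complex ^ 'm) \<Rightarrow> ('k \<Rightarrow> real) \<Rightarrow> (real ^ 'k) set" where
  "F B h \<gamma> = F1 B h \<inter> {\<beta>. \<beta> \<le> interference B h \<gamma> \<beta>}"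

end

theory Submission
  imports Defs
begin

text \<open>By Cauchy-Schwarz for the form of a positive semidefinite C, the largest t with
  C \<succeq> t h h^H is 1 / (h^H C^+ h) if h lies in the range of C, and 0 otherwise. Hence dual feasibility
  of \<open>\<beta>\<close> means \<open>\<beta> \<ge> 0\<close>, \<open>C(\<beta>) \<succeq> 0\<close> and \<open>\<beta> \<le> I(\<beta>)\<close>, and I is monotone. The dual feasible set is therefore
  closed under componentwise maxima; by weak duality it is compact, so it has a greatest element, which
  is the only maximiser of the strictly monotone objective. Replacing it by its image under I stays
  feasible, so it is a fixed point. Conversely, if the primal is bounded, separating the cone of
  achievable (constraint, objective) values from a point below the optimum gives multipliers;
  a primal feasible point has strictly positive constraint values since the noise powers are
  positive, so the objective multiplier is nonzero, and testing
  on rank-one matrices shows that the normalised multipliers are dual feasible.\<close>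

section \<open>Positive semidefinite complex matrices\<close>

lemma cinner_simps [simp]:
  fixes x y z :: "complex ^ 'n"
  shows cinner_add_left: "cinner (x + y) z = cinner x z + cinner y z"
    and cinner_add_right: "cinner x (y + z) = cinner x y + cinner x z"
    and cinner_diff_left: "cinner (x - y) z = cinner x z - cinner y z"
    and cinner_diff_right: "cinner x (y - z) = cinner x y - cinner x z"
    and cinner_scale_left: "cinner (c *s x) y = cnj c * cinner x y"
    and cinner_scale_right: "cinner x (c *s y) = c * cinner x y"
    and cinner_scaleR_left: "cinner (r *\<^sub>R x) y = of_real r * cinner x y"
    and cinner_scaleR_right: "cinner x (r *\<^sub>R y) = of_real r * cinner x y"
    and cinner_zero_left: "cinner 0 x = 0"
    and cinner_zero_right: "cinner x 0 = 0"
  by (simp_all add: cinner_def algebra_simps sum.distrib sum_subtractf sum_distrib_left)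
    (simp_all add: scaleR_conv_of_real sum_distrib_left mult_ac)

lemma cnj_cinner: "cnj (cinner x y) = cinner y x"
  by (simp add: cinner_def mult.commute)

lemma Re_cinner: "Re (cinner x y) = x \<bullet> y"
  by (simp add: cinner_def inner_vec_def inner_complex_def)

lemma cinner_self: "cinner x x = of_real ((norm x)\<^sup>2)"
proof (rule complex_eqI)
  show "Im (cinner x x) = Im (of_real ((norm x)\<^sup>2))"
    using cnj_cinner[of x x] by (simp add: complex_eq_iff)
qed (simp add: Re_cinner power2_norm_eq_inner)

lemma cinner_conj_transpose: "cinner (A *v x) y = cinner x (conj_transpose A *v y)"
  unfolding cinner_def matrix_vector_mult_def conj_transpose_def
  by (simp add: sum_distrib_left sum_distrib_right mult_ac) (rule sum.swap)

lemma cinner_hermitian: "hermitian A \<Longrightarrow> cinner (A *v x) y = cinner x (A *v y)"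
  by (simp add: cinner_conj_transpose hermitian_def)

lemma scaleR_matrix_vector: "(r *\<^sub>R A) *v x = r *\<^sub>R (A *v x)" for A :: "complex ^ 'n ^ 'm"
  by (simp add: matrix_vector_mult_def vec_eq_iff scaleR_sum_right)

lemma matrix_vector_scaleR: "A *v (r *\<^sub>R x) = r *\<^sub>R (A *v x)" for A :: "complex ^ 'n ^ 'm"
  by (simp add: matrix_vector_mult_def vec_eq_iff scaleR_sum_right)

lemma outer_mult: "outer e *v x = cinner e x *s e"
  by (simp add: outer_def matrix_vector_mult_def cinner_def vec_eq_iff sum_distrib_left sum_distrib_right mult_ac)

lemma hermitian_simps:
  shows hermitian_add: "hermitian A \<Longrightarrow> hermitian A' \<Longrightarrow> hermitian (A + A')"
    and hermitian_diff: "hermitian A \<Longrightarrow> hermitian A' \<Longrightarrow> hermitian (A - A')"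
    and hermitian_scaleR: "hermitian A \<Longrightarrow> hermitian (r *\<^sub>R A)"
    and hermitian_outer: "hermitian (outer e)"
    and hermitian_zero: "hermitian 0"
    and hermitian_one: "hermitian (mat 1)"
  by (simp_all add: hermitian_def conj_transpose_def vec_eq_iff outer_def mat_def)

lemma hermitian_sum: "(\<And>i. i \<in> S \<Longrightarrow> hermitian (f i)) \<Longrightarrow> hermitian (sum f S)"
  by (induction S rule: infinite_finite_induct) (auto intro: hermitian_zero hermitian_add)

section \<open>The real quadratic form of a matrix and its Cauchy-Schwarz inequality\<close>

definition quad :: "complex ^ 'n ^ 'n \<Rightarrow> complex ^ 'n \<Rightarrow> real" where
  "quad A x = Re (cinner x (A *v x))"

lemma quad_simps [simp]:
  shows quad_add: "quad (A + A') x = quad A x + quad A' x"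
    and quad_diff: "quad (A - A') x = quad A x - quad A' x"
    and quad_scaleR: "quad (r *\<^sub>R A) x = r * quad A x"
    and quad_zero: "quad 0 x = 0"
    and quad_one: "quad (mat 1) x = (norm x)\<^sup>2"
  by (simp_all add: quad_def matrix_vector_mult_add_rdistrib matrix_vector_mult_diff_rdistrib
      scaleR_matrix_vector cinner_self)

lemma quad_outer [simp]: "quad (outer e) x = (cmod (cinner e x))\<^sup>2"
proof -
  have "cinner x (outer e *v x) = cinner e x * cnj (cinner e x)"
    by (simp add: outer_mult cnj_cinner)
  also have "\<dots> = of_real ((cmod (cinner e x))\<^sup>2)"
    by (simp only: complex_norm_square)
  finally show ?thesis
    by (simp add: quad_def)
qed

lemma quad_sum: "quad (sum f S) x = (\<Sum>i\<in>S. quad (f i) x)"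
  by (induction S rule: infinite_finite_induct) auto

lemma psd_iff: "psd A \<longleftrightarrow> hermitian A \<and> (\<forall>x. 0 \<le> quad A x)"
  by (simp add: psd_def quad_def)

lemma psd_hermitian: "psd A \<Longrightarrow> hermitian A" and psd_quad: "psd A \<Longrightarrow> 0 \<le> quad A x"
  by (simp_all add: psd_iff)

lemma psd_add: "psd A \<Longrightarrow> psd A' \<Longrightarrow> psd (A + A')"
  and psd_scaleR: "0 \<le> r \<Longrightarrow> psd A \<Longrightarrow> psd (r *\<^sub>R A)"
  and psd_outer: "psd (outer e)"
  and psd_zero: "psd 0"
  by (simp_all add: psd_iff hermitian_simps)

text \<open>Discriminant argument: moving from \<open>x\<close> along a suitable multiple of
  \<open>y\<close> makes both cross terms real, which leaves a nonnegative real polynomial in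
  \<open>s\<close> of degree at most two.\<close>

lemma psd_cauchy_schwarz:
  assumes "psd A"
  shows "(cmod (cinner x (A *v y)))\<^sup>2 \<le> quad A x * quad A y"
proof -
  define z where "z = cinner x (A *v y)"
  have yx: "cinner y (A *v x) = cnj z"
    using cinner_hermitian[OF psd_hermitian[OF assms], of x y] by (metis z_def cnj_cinner cinner_hermitian[OF psd_hermitian[OF assms]])
  have main: "0 \<le> quad A x - 2 * s * (cmod z)\<^sup>2 + s\<^sup>2 * (cmod z)\<^sup>2 * quad A y" for s :: real
  proof -
    \<comment> \<open>This phase turns \<open>c * z\<close> into the real number
      \<open>- s * (cmod z)\<^sup>2\<close>.\<close>
    define c where "c = - (of_real s * cnj z)"
    have "quad A (x + c *s y) = quad A x + Re (c * z) + Re (cnj (c * z)) + Re (cnj c * c * cinner y (A *v y))"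
      by (simp add: quad_def matrix_vector_right_distrib vector_scalar_commute yx z_def[symmetric] algebra_simps)
    moreover have "cnj c * c = of_real (s\<^sup>2 * (cmod z)\<^sup>2)"
      unfolding of_real_mult complex_norm_square by (simp add: c_def mult_ac power2_eq_square)
    moreover have "c * z = of_real (- s * (cmod z)\<^sup>2)"
      unfolding of_real_mult complex_norm_square by (simp add: c_def mult_ac)
    moreover have "0 \<le> quad A (x + c *s y)"
      using assms by (rule psd_quad)
    ultimately show ?thesis
      by (simp add: quad_def)
  qed
  show ?thesis
  proof (cases "quad A y = 0")
    case True
    \<comment> \<open>The bound is affine in \<open>s\<close> here; if \<open>z\<close> were
      nonzero, the chosen \<open>s\<close> would give it the value -1.\<close>
    have "z = 0"
    proof (rule ccontr)
      assume "z \<noteq> 0"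
      then show False
        using main[of "(quad A x + 1) / (2 * (cmod z)\<^sup>2)"] psd_quad[OF assms, of x] True by simp
    qed
    then show ?thesis using True by (simp add: z_def)
  next
    case False
    then have pos: "quad A y > 0" using psd_quad[OF assms, of y] by simp
    \<comment> \<open>The value \<open>s = 1 / quad A y\<close> minimises the quadratic.\<close>
    then show ?thesis
      using main[of "1 / quad A y"] by (simp add: z_def[symmetric] field_simps power2_eq_square)
  qed
qed

text \<open>Cauchy-Schwarz with \<open>A *v x\<close> itself as the test vector.\<close>

lemma psd_quad_eq_0:
  assumes "psd A" "quad A x = 0"
  shows "A *v x = 0"
proof -
  have "cinner (A *v x) (A *v x) = 0"
    using psd_cauchy_schwarz[OF assms(1), of "A *v x" x] assms(2) by simp
  then show ?thesis
    by (simp add: cinner_self)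
qed

text \<open>If e maximises the Rayleigh quotient, with value l, then l I - V is positive semidefinite and its
  quadratic form vanishes at e, so it annihilates e.\<close>
lemma psd_eigenvector:
  assumes "psd V" "V \<noteq> 0"
  obtains e l where "norm e = 1" "l > 0" "V *v e = l *\<^sub>R e"
proof -
  have cont: "continuous_on (sphere 0 1) (quad V)"
    unfolding quad_def Re_cinner by (intro continuous_intros) 
  obtain e where e: "norm e = 1" "\<And>x. norm x = 1 \<Longrightarrow> quad V x \<le> quad V e"
  proof -
    have "sphere (0 :: complex ^ 'a) 1 \<noteq> {}" by simp
    from continuous_attains_sup[OF compact_sphere this cont] that show ?thesis
      by (auto simp: dist_norm)
  qed
  define A where "A = quad V e *\<^sub>R mat 1 - V"
  have "0 \<le> quad A x" for x
  proof (cases "x = 0")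
    case False
    have "quad V x = (norm x)\<^sup>2 * quad V (sgn x)"
      using False by (simp add: sgn_div_norm quad_def matrix_vector_scaleR power2_eq_square)
    also have "\<dots> \<le> (norm x)\<^sup>2 * quad V e"
      using False e(2)[of "sgn x"] by (intro mult_left_mono) (auto simp: norm_sgn)
    finally show ?thesis by (simp add: A_def mult.commute)
  qed (simp add: quad_def)
  then have "psd A"
    using assms(1) by (simp add: psd_iff A_def hermitian_simps)
  moreover have "quad A e = 0"
    by (simp add: A_def e)
  ultimately have "A *v e = 0" by (rule psd_quad_eq_0)
  then have eig: "V *v e = quad V e *\<^sub>R e"
    by (simp add: A_def matrix_vector_mult_diff_rdistrib scaleR_matrix_vector)
  \<comment> \<open>If the largest Rayleigh quotient were 0, the form of \<open>V\<close> would
    vanish everywhere, forcing \<open>V = 0\<close>.\<close>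
  moreover have "quad V e > 0"
  proof (rule ccontr)
    assume "\<not> ?thesis"
    then have "quad V e = 0" using psd_quad[OF assms(1), of e] by simp
    then have "quad V x = 0" for x
      using psd_quad[OF assms(1), of x] psd_quad[OF \<open>psd A\<close>, of x] \<open>quad V e = 0\<close>
      unfolding A_def quad_diff quad_scaleR by simp
    then have "V *v x = 0" for x using assms(1) psd_quad_eq_0 by blast
    then show False using assms(2) by (metis matrix_eq matrix_vector_mult_0)
  qed
  ultimately show ?thesis using that e(1) by blast
qed

text \<open>Stands in for the spectral theorem: removing one eigencomponent keeps the matrix
  positive semidefinite and enlarges its kernel, so the induction runs on the real codimension of
  the kernel. The premise \<open>V *v e = 0\<close> says that the new direction is orthogonal to the
  range built so far.\<close>

lemma psd_induct [consumes 1, case_names zero add]: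
  assumes "psd V"
    and zero: "P 0"
    and add: "\<And>V e l. psd V \<Longrightarrow> P V \<Longrightarrow> V *v e = 0 \<Longrightarrow> norm e = 1 \<Longrightarrow> l > 0 \<Longrightarrow> P (V + l *\<^sub>R outer e)"
  shows "P V"
  using assms(1)
proof (induction "DIM(complex ^ 'a) - dim {x. V *v x = 0}" arbitrary: V rule: less_induct)
  case less
  show ?case
  proof (cases "V = 0")
    case False
    then obtain e l where e: "norm e = 1" "l > 0" "V *v e = l *\<^sub>R e"
      using psd_eigenvector less.prems by blast
    define W where "W = V - l *\<^sub>R outer e"
    have herm: "hermitian V" using less.prems by (rule psd_hermitian)
    have Ve: "cinner e (V *v x) = of_real l * cinner e x" for x
      using cinner_hermitian[OF herm, of e x] e by simp
    have We: "W *v e = 0"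
      by (simp add: W_def matrix_vector_mult_diff_rdistrib scaleR_matrix_vector e outer_mult cinner_self)
    have ker: "W *v x = 0" if "V *v x = 0" for x
      using that Ve[of x] e(2)
      by (simp add: W_def matrix_vector_mult_diff_rdistrib scaleR_matrix_vector outer_mult)
    have "0 \<le> quad W x" for x
    proof -
      \<comment> \<open>Cauchy-Schwarz at the eigenvector, where \<open>quad V e = l\<close>; one
        factor \<open>l\<close> then cancels.\<close>
      have "(cmod (cinner e (V *v x)))\<^sup>2 \<le> quad V e * quad V x"
        using less.prems by (rule psd_cauchy_schwarz)
      then have "l * (l * (cmod (cinner e x))\<^sup>2) \<le> l * quad V x"
        using e by (simp add: Ve norm_mult power_mult_distrib quad_def cinner_self power2_eq_square mult_ac)
      then show ?thesis using e(2) by (simp add: W_def)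
    qed
    then have psdW: "psd W"
      by (simp add: psd_iff W_def hermitian_simps herm)
    have sub: "subspace {x. A *v x = 0}" for A :: "complex ^ 'a ^ 'a"
      by (simp add: subspace_def matrix_vector_right_distrib matrix_vector_scaleR)
    \<comment> \<open>The vector \<open>e\<close> witnesses strictness: \<open>W\<close> kills it,
      \<open>V\<close> does not.\<close>
    have "{x. V *v x = 0} \<subset> {x. W *v x = 0}"
      using ker We e by (auto simp: psubset_eq dest!: equalityD2[THEN subsetD, of _ _ e])
    then have "dim {x. V *v x = 0} < dim {x. W *v x = 0}"
      by (metis dim_psubset span_eq_iff sub)
    then have "P W"
      using less.hyps[OF _ psdW] dim_subset_UNIV[of "{x. W *v x = 0}"] by simp
    from add[OF psdW this We e(1,2)] show ?thesis by (simp add: W_def)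
  qed (simp add: zero)
qed

section \<open>Pseudoinverse and rank-one domination\<close>

lemma matrix_mult_simps:
  fixes A A' :: "complex ^ 'n ^ 'm" and X X' :: "complex ^ 'l ^ 'n"
  shows "(A + A') ** X = A ** X + A' ** X" and "A ** (X + X') = A ** X + A ** X'"
    and "(r *\<^sub>R A) ** X = r *\<^sub>R (A ** X)" and "A ** (r *\<^sub>R X) = r *\<^sub>R (A ** X)"
    and "0 ** X = 0" and "A ** 0 = 0"
  by (simp_all add: matrix_matrix_mult_def vec_eq_iff scaleR_sum_right algebra_simps sum.distrib)

lemma mult_outer: "(A ** outer e) *v x = cinner e x *s (A *v e)"
  by (simp only: matrix_vector_mul_assoc[symmetric] outer_mult vector_scalar_commute)

lemma outer_idem:
  assumes "norm e = 1"
  shows "outer e ** outer e = outer e"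
  unfolding matrix_eq mult_outer by (simp add: assms outer_mult cinner_self)

text \<open>Since \<open>V\<close> and the projection \<open>E\<close> annihilate each other, a
  pseudoinverse \<open>X\<close> of \<open>V\<close> extends to
  \<open>X + (1 / l) *\<^sub>R E\<close>.\<close>

lemma psd_penrose:
  assumes "psd V"
  shows "\<exists>X. penrose V X"
  using assms
proof (induction rule: psd_induct)
  case zero
  have "penrose 0 (0 :: complex ^ 'a ^ 'a)"
    by (simp add: penrose_def matrix_mult_simps hermitian_zero)
  then show ?case ..
next
  case (add V e l)
  then obtain X where X: "penrose V X" by blast
  define E where "E = outer e"
  have VX: "V ** X ** V = V" "X ** V ** X = X" "hermitian (V ** X)" "hermitian (X ** V)"
    using X by (auto simp: penrose_def)
  have hV: "hermitian V" using add by (simp add: psd_hermitian)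
  have VE: "V ** E = 0"
    unfolding matrix_eq E_def mult_outer by (simp add: add)
  have cV: "conj_transpose V = V" and cE: "conj_transpose E = E"
    using hV hermitian_outer[of e] by (simp_all add: hermitian_def E_def)
  have cVX: "conj_transpose (V ** X) = V ** X" and cXV: "conj_transpose (X ** V) = X ** V"
    using VX by (simp_all add: hermitian_def)
  have EV: "E ** V = 0"
    using arg_cong[OF VE, of conj_transpose] hermitian_zero
    unfolding conj_transpose_mult cV cE hermitian_def by metis
  \<comment> \<open>The relation \<open>V ** E = 0\<close> passes to \<open>X\<close> by inserting
    \<open>X = X ** V ** X\<close> and rewriting the hermitian product \<open>V ** X\<close> as its
    adjoint.\<close>
  have "X ** E = X ** V ** X ** E" unfolding VX(2) ..
  also have "\<dots> = X ** (conj_transpose (V ** X) ** E)" unfolding cVX matrix_mul_assoc ..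
  also have "\<dots> = X ** (conj_transpose X ** (V ** E))"
    unfolding conj_transpose_mult cV matrix_mul_assoc ..
  finally have XE: "X ** E = 0" unfolding VE matrix_mult_simps .
  have "E ** X = E ** (X ** V ** X)" unfolding VX(2) ..
  also have "\<dots> = E ** conj_transpose (X ** V) ** X" unfolding cXV matrix_mul_assoc ..
  also have "\<dots> = E ** V ** conj_transpose X ** X"
    unfolding conj_transpose_mult cV matrix_mul_assoc ..
  finally have EX: "E ** X = 0" unfolding EV matrix_mult_simps .
  have EE: "E ** E = E" using add by (simp add: E_def outer_idem)
  let ?W = "V + l *\<^sub>R E" and ?Y = "X + (1 / l) *\<^sub>R E"
  have WY: "?W ** ?Y = V ** X + E" and YW: "?Y ** ?W = X ** V + E"
    using add.hyps by (simp_all add: matrix_mult_simps VE EV XE EX EE)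
  have VXE: "V ** X ** E = 0" and XVE: "X ** V ** E = 0"
    unfolding matrix_mul_assoc[symmetric] XE VE matrix_mult_simps by simp_all
  have "penrose ?W ?Y"
    unfolding penrose_def WY YW
    using VX hermitian_outer[of e]
    by (simp add: matrix_mult_simps VXE XVE EV EX EE hermitian_add E_def[symmetric])
  then show ?case unfolding E_def by blast
qed

lemma penrose_pinv:
  assumes "psd V"
  shows "penrose V (pinv V)"
proof -
  obtain X where "penrose V X" using psd_penrose[OF assms] ..
  then show ?thesis
    unfolding pinv_def by (rule theI) (rule penrose_unique[OF _ \<open>penrose V X\<close>])
qed

text \<open>Evaluates the pseudoinverse form on the range of \<open>C\<close> through any preimage
  \<open>y\<close>, by \<open>C ** pinv C ** C = C\<close>.\<close>

lemma cinner_pinv: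
  assumes "psd C"
  shows "cinner (C *v y) (pinv C *v (C *v y)) = cinner y (C *v y)"
proof -
  have "C ** pinv C ** C = C"
    using penrose_pinv[OF assms] by (simp add: penrose_def)
  then have "C *v (pinv C *v (C *v y)) = C *v y"
    by (metis matrix_vector_mul_assoc)
  then show ?thesis
    by (simp add: cinner_hermitian[OF psd_hermitian[OF assms]])
qed

lemma psd_quad_of_real:
  assumes "psd C"
  shows "cinner y (C *v y) = of_real (quad C y)"
proof -
  have "cnj (cinner y (C *v y)) = cinner y (C *v y)"
    unfolding cnj_cinner by (rule cinner_hermitian[OF psd_hermitian[OF assms]])
  then have "Im (cinner y (C *v y)) = 0"
    by (metis cnj.sel(2) equal_neg_zero)
  then show ?thesis
    by (simp add: quad_def complex_eq_iff)
qed

text \<open>The residual \<open>n\<close> of \<open>h\<close> after projection to the range lies in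
  the kernel of \<open>C\<close>. The bound at \<open>n\<close> makes \<open>h\<close> orthogonal to
  \<open>n\<close>, and so does the projected part, hence \<open>n = 0\<close>.\<close>

lemma outer_dominated_in_range:
  assumes C: "psd C" and t: "t > 0" and le: "\<And>x. t * (cmod (cinner h x))\<^sup>2 \<le> quad C x"
  shows "h \<in> mat_range C"
proof -
  define X where "X = pinv C"
  have X: "C ** X ** C = C" "hermitian (C ** X)"
    using penrose_pinv[OF C] by (auto simp: penrose_def X_def)
  have hC: "hermitian C" using C by (rule psd_hermitian)
  define n where "n = h - C *v (X *v h)"
  \<comment> \<open>Taking adjoints moves the projection \<open>C ** X\<close> to the right of
    \<open>C\<close>.\<close>
  have "C = conj_transpose (C ** X ** C)" using X hC by (simp add: hermitian_def)
  also have "\<dots> = conj_transpose C ** conj_transpose (C ** X)" by (rule conj_transpose_mult)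
  also have "\<dots> = C ** (C ** X)" using X hC unfolding hermitian_def by simp
  finally have Cn: "C *v n = 0"
    by (metis n_def matrix_vector_mul_assoc matrix_vector_mult_diff_distrib right_minus_eq)
  have "cinner h n = 0"
    using le[of n] t by (simp add: quad_def Cn mult_le_0_iff)
  moreover have "cinner (C *v (X *v h)) n = 0"
    by (simp add: cinner_hermitian[OF hC] Cn)
  ultimately have "cinner n n = 0" by (simp add: n_def)
  then have "h = C *v (X *v h)" by (simp add: cinner_self n_def)
  then show ?thesis unfolding mat_range_def by blast
qed

text \<open>For \<open>h = C *v y\<close> the bound is Cauchy-Schwarz applied to
  \<open>cinner y (C *v x)\<close>, sharp at \<open>x = y\<close>; \<open>h \<noteq> 0\<close> makes
  \<open>quad C y\<close> positive. Outside the range only \<open>t = 0\<close> remains.\<close>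

lemma outer_dominated_iff:
  assumes C: "psd C" and h: "h \<noteq> 0" and t: "t \<ge> 0"
  shows "(\<forall>x. t * (cmod (cinner h x))\<^sup>2 \<le> quad C x) \<longleftrightarrow>
    t \<le> (if h \<in> mat_range C then 1 / Re (cinner h (pinv C *v h)) else 0)"
proof (cases "h \<in> mat_range C")
  case True
  then obtain y where y: "h = C *v y" by (auto simp: mat_range_def)
  have "quad C y \<noteq> 0" using psd_quad_eq_0[OF C, of y] y h by auto
  then have pos: "quad C y > 0" using psd_quad[OF C, of y] by simp
  have hx: "cinner h x = cinner y (C *v x)" for x
    by (simp add: y cinner_hermitian[OF psd_hermitian[OF C]])
  have "Re (cinner h (pinv C *v h)) = quad C y"
    using C by (simp add: y cinner_pinv quad_def)
  moreover have "(\<forall>x. t * (cmod (cinner h x))\<^sup>2 \<le> quad C x) \<longleftrightarrow> t \<le> 1 / quad C y"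
  proof
    assume "\<forall>x. t * (cmod (cinner h x))\<^sup>2 \<le> quad C x"
    then have "t * (cmod (cinner h y))\<^sup>2 \<le> quad C y" by blast
    then have "t * (quad C y)\<^sup>2 \<le> quad C y"
      by (simp add: hx psd_quad_of_real[OF C])
    then show "t \<le> 1 / quad C y"
      using pos by (simp add: field_simps power2_eq_square)
  next
    assume le: "t \<le> 1 / quad C y"
    show "\<forall>x. t * (cmod (cinner h x))\<^sup>2 \<le> quad C x"
    proof
      fix x
      have "t * (cmod (cinner h x))\<^sup>2 \<le> (1 / quad C y) * (quad C y * quad C x)"
        using le psd_cauchy_schwarz[OF C, of y x] pos t
        by (intro mult_mono) (auto simp: hx)
      then show "t * (cmod (cinner h x))\<^sup>2 \<le> quad C x" using pos by simp
    qed
  qed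
  ultimately show ?thesis using True by simp
next
  case False
  then have "t \<le> 0" if "\<forall>x. t * (cmod (cinner h x))\<^sup>2 \<le> quad C x"
    using that outer_dominated_in_range[OF C, of t h] by force
  moreover have "\<forall>x. t * (cmod (cinner h x))\<^sup>2 \<le> quad C x" if "t \<le> 0"
    using that t psd_quad[OF C] by simp
  ultimately show ?thesis using False by auto
qed

section \<open>Traces against rank-one and positive semidefinite matrices\<close>

lemma cmod_cinner_commute: "cmod (cinner x y) = cmod (cinner y x)"
  by (metis cnj_cinner complex_mod_cnj)

lemma trace_mult_outer: "trace (A ** outer e) = cinner e (A *v e)"
  by (simp add: trace_def matrix_matrix_mult_def matrix_vector_mult_def cinner_def outer_def
      sum_distrib_left mult_ac)

lemma trace_outer_mult: "trace (outer e ** A) = cinner e (A *v e)"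
  by (simp only: trace_mul_sym[of "outer e"] trace_mult_outer)

lemma trace_simps:
  fixes A A' :: "complex ^ 'n ^ 'n"
  shows "trace (A + A') = trace A + trace A'" and "trace (r *\<^sub>R A) = of_real r * trace A"
    and "trace (0 :: complex ^ 'n ^ 'n) = 0"
  by (simp_all add: trace_def sum.distrib sum_distrib_left) (simp add: scaleR_conv_of_real)

lemma Re_trace_mult_sum:
  fixes A :: "complex ^ 'n ^ 'n"
  shows "Re (trace (A ** (\<Sum>i\<in>S. V i))) = (\<Sum>i\<in>S. Re (trace (A ** V i)))"
  by (induction S rule: infinite_finite_induct) (simp_all add: matrix_mult_simps trace_simps)

lemma Re_trace_sum_mult:
  fixes A :: "complex ^ 'n ^ 'n"
  shows "Re (trace ((\<Sum>i\<in>S. V i) ** A)) = (\<Sum>i\<in>S. Re (trace (V i ** A)))"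
  by (induction S rule: infinite_finite_induct) (simp_all add: matrix_mult_simps trace_simps)

text \<open>Both sides are linear in \<open>V\<close>, so rank-one matrices suffice; for
  \<open>outer e\<close> the claim is the hypothesis at \<open>e\<close>.\<close>

lemma trace_dominates_outer:
  assumes "psd V" and le: "\<And>x. c * (cmod (cinner g x))\<^sup>2 \<le> quad A x"
  shows "c * quad V g \<le> Re (trace (A ** V))"
  using assms(1)
proof (induction rule: psd_induct)
  case zero
  then show ?case by (simp add: matrix_mult_simps trace_simps)
next
  case (add V e l)
  have "l * (c * (cmod (cinner e g))\<^sup>2) \<le> l * quad A e"
    using le[of e] add.hyps by (simp add: cmod_cinner_commute)
  then show ?case
    using add.IH by (simp add: matrix_mult_simps trace_simps trace_mult_outer algebra_simps flip: quad_def)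
qed

section \<open>Duality and the interference function\<close>

lemma gdb_objective_sum: "gdb_objective B V = (\<Sum>k\<in>UNIV. Re (trace (B ** V k)))"
  by (simp add: gdb_objective_def Re_trace_mult_sum)

lemma quad_C_mat:
  "quad (C_mat B h \<beta>) x = quad B x + (\<Sum>j\<in>UNIV. \<beta> $ j * (cmod (cinner (h j) x))\<^sup>2)"
  by (simp add: C_mat_def quad_sum)

lemma trace_C_mat:
  "Re (trace (C_mat B h \<beta> ** V)) = Re (trace (B ** V)) + (\<Sum>j\<in>UNIV. \<beta> $ j * quad V (h j))"
  by (simp add: C_mat_def matrix_mult_simps trace_simps Re_trace_sum_mult trace_outer_mult quad_def)

lemma hermitian_C_mat: "hermitian B \<Longrightarrow> hermitian (C_mat B h \<beta>)"
  unfolding C_mat_def by (intro hermitian_add hermitian_sum hermitian_scaleR hermitian_outer)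

lemma quad_C_mat_mono: "\<beta> \<le> \<beta>' \<Longrightarrow> quad (C_mat B h \<beta>) x \<le> quad (C_mat B h \<beta>') x"
  by (auto simp: quad_C_mat less_eq_vec_def intro!: sum_mono mult_right_mono)

text \<open>Scalar inequalities affine in \<open>\<beta>\<close>, the form suited to closedness and
  monotonicity arguments.\<close>

lemma dual_feasible_iff:
  assumes "hermitian B"
  shows "\<beta> \<in> dual_feasible B h \<gamma> \<longleftrightarrow> 0 \<le> \<beta> \<and>
    (\<forall>k x. \<beta> $ k * (\<gamma> k + 1) / \<gamma> k * (cmod (cinner (h k) x))\<^sup>2 \<le> quad (C_mat B h \<beta>) x)"
  using hermitian_C_mat[OF assms, of h \<beta>]
  by (simp add: dual_feasible_def loewner_ge_def psd_iff hermitian_diff hermitian_scaleR hermitian_outer)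

lemma gdb_feasible_iff:
  "V \<in> gdb_feasible h \<gamma> s2 \<longleftrightarrow> (\<forall>k. psd (V k)) \<and>
    (\<forall>k. (\<Sum>j\<in>UNIV. quad (V j) (h k)) + s2 k \<le> (1 + 1 / \<gamma> k) * quad (V k) (h k))"
  by (simp add: gdb_feasible_def quad_def)

text \<open>Dual constraint \<open>k\<close> is tested against \<open>V k\<close>, primal constraint
  \<open>k\<close> is weighted by \<open>\<beta> $ k\<close>; after swapping the double sum the
  interference terms cancel.\<close>

lemma weak_duality:
  fixes \<beta> :: "real ^ 'k"
  assumes B: "hermitian B" and \<gamma>: "\<And>k. \<gamma> k > 0"
    and \<beta>: "\<beta> \<in> dual_feasible B h \<gamma>" and V: "V \<in> gdb_feasible h \<gamma> s2"
  shows "(\<Sum>k\<in>UNIV. \<beta> $ k * s2 k) \<le> gdb_objective B V"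
proof -
  have psdV: "psd (V k)" for k using V by (simp add: gdb_feasible_iff)
  have pos: "0 \<le> \<beta> $ k" for k using \<beta> by (simp add: dual_feasible_iff[OF B] less_eq_vec_def)
  have eq: "\<beta> $ k * (\<gamma> k + 1) / \<gamma> k = \<beta> $ k * (1 + 1 / \<gamma> k)" for k
    using \<gamma>[of k] by (simp add: field_simps)
  have "\<beta> $ k * (1 + 1 / \<gamma> k) * quad (V k) (h k)
      \<le> Re (trace (B ** V k)) + (\<Sum>j\<in>UNIV. \<beta> $ j * quad (V k) (h j))" for k
    unfolding trace_C_mat[symmetric]
    using \<beta> by (intro trace_dominates_outer psdV) (simp add: dual_feasible_iff[OF B] eq)
  then have "(\<Sum>k\<in>UNIV. \<beta> $ k * (1 + 1 / \<gamma> k) * quad (V k) (h k))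
      \<le> gdb_objective B V + (\<Sum>k\<in>UNIV. \<Sum>j\<in>UNIV. \<beta> $ j * quad (V k) (h j))"
    unfolding gdb_objective_sum sum.distrib[symmetric] by (rule sum_mono)
  moreover have "(\<Sum>k\<in>UNIV. \<Sum>j\<in>UNIV. \<beta> $ j * quad (V k) (h j))
      = (\<Sum>k\<in>UNIV. \<beta> $ k * (\<Sum>j\<in>UNIV. quad (V j) (h k)))"
    by (subst sum.swap) (simp add: sum_distrib_left)
  moreover have "\<beta> $ k * ((\<Sum>j\<in>UNIV. quad (V j) (h k)) + s2 k)
      \<le> \<beta> $ k * ((1 + 1 / \<gamma> k) * quad (V k) (h k))" for k
    using V pos[of k] by (intro mult_left_mono) (auto simp: gdb_feasible_iff)
  then have "(\<Sum>k\<in>UNIV. \<beta> $ k * ((\<Sum>j\<in>UNIV. quad (V j) (h k)) + s2 k))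
      \<le> (\<Sum>k\<in>UNIV. \<beta> $ k * ((1 + 1 / \<gamma> k) * quad (V k) (h k)))"
    by (rule sum_mono)
  ultimately show ?thesis
    by (simp add: algebra_simps sum.distrib)
qed

section \<open>The dual feasible set in terms of the interference function\<close>

lemma gdb_feasible_channel_nonzero:
  assumes "V \<in> gdb_feasible h \<gamma> s2" "s2 k > 0"
  shows "h k \<noteq> 0"
  using assms by (auto simp: gdb_feasible_iff quad_def dest!: spec[of _ k])

lemma dual_feasible_psd:
  assumes "hermitian B" "\<And>k. \<gamma> k > 0" "\<beta> \<in> dual_feasible B h \<gamma>"
  shows "psd (C_mat B h \<beta>)"
proof -
  \<comment> \<open>Index types are nonempty, so at least one constraint is present to bound the
    form from below.\<close>
  fix k :: 'b
  have "0 \<le> quad (C_mat B h \<beta>) x" for x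
  proof -
    have "0 \<le> \<beta> $ k * (\<gamma> k + 1) / \<gamma> k * (cmod (cinner (h k) x))\<^sup>2"
      using assms(2)[of k] assms(3) by (simp add: dual_feasible_iff[OF assms(1)] less_eq_vec_def)
    then show ?thesis
      using assms(3) dual_feasible_iff[OF assms(1)] order_trans by blast
  qed
  then show ?thesis
    by (simp add: psd_iff hermitian_C_mat assms(1))
qed

text \<open>The number \<open>t\<close> is kept apart from \<open>\<beta>\<close> so that it can be
  0, \<open>\<beta> $ k\<close> or the interference value itself.\<close>

lemma le_interference_iff:
  assumes C: "psd (C_mat B h \<beta>)" and h: "h k \<noteq> 0" and \<gamma>: "\<gamma> k > 0" and t: "0 \<le> t"
  shows "t \<le> interference B h \<gamma> \<beta> $ k \<longleftrightarrow>
    (\<forall>x. t * (\<gamma> k + 1) / \<gamma> k * (cmod (cinner (h k) x))\<^sup>2 \<le> quad (C_mat B h \<beta>) x)"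
proof -
  define T where "T = (if h k \<in> mat_range (C_mat B h \<beta>)
    then 1 / Re (cinner (h k) (pinv (C_mat B h \<beta>) *v h k)) else 0)"
  have "interference B h \<gamma> \<beta> $ k = \<gamma> k / (\<gamma> k + 1) * T"
    by (simp add: interference_def T_def)
  moreover have "t \<le> \<gamma> k / (\<gamma> k + 1) * T \<longleftrightarrow> t * (\<gamma> k + 1) / \<gamma> k \<le> T"
    using \<gamma> by (simp add: field_simps)
  ultimately show ?thesis
    using outer_dominated_iff[OF C h, of "t * (\<gamma> k + 1) / \<gamma> k"] t \<gamma> by (simp add: T_def)
qed

lemma interference_nonneg:
  assumes "psd (C_mat B h \<beta>)" "\<And>k. h k \<noteq> 0" "\<And>k. \<gamma> k > 0"
  shows "0 \<le> interference B h \<gamma> \<beta>"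
  using le_interference_iff[OF assms(1,2,3), where t = 0] psd_quad[OF assms(1)]
  by (simp add: less_eq_vec_def)

text \<open>No range condition appears: where \<open>h k\<close> leaves the range, the default value
  0 of \<open>interference\<close> forces \<open>\<beta> $ k = 0\<close>, just as the dual
  constraint does.\<close>

lemma dual_feasible_iff_le_interference:
  assumes "hermitian B" "\<And>k. h k \<noteq> 0" "\<And>k. \<gamma> k > 0"
  shows "\<beta> \<in> dual_feasible B h \<gamma> \<longleftrightarrow>
    0 \<le> \<beta> \<and> psd (C_mat B h \<beta>) \<and> \<beta> \<le> interference B h \<gamma> \<beta>"
proof (cases "0 \<le> \<beta> \<and> psd (C_mat B h \<beta>)")
  case True
  then have "0 \<le> \<beta> $ k" for k by (simp add: less_eq_vec_def)
  then show ?thesis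
    using le_interference_iff[of B h \<beta> _ \<gamma>] True assms(2,3)
    by (simp add: dual_feasible_iff[OF assms(1)] less_eq_vec_def)
next
  case False
  then show ?thesis
    using dual_feasible_psd[where h = h and \<gamma> = \<gamma>, OF assms(1,3)] dual_feasible_iff[OF assms(1)] by blast
qed

lemma F_subset_dual_feasible:
  assumes "hermitian B" "\<And>k. h k \<noteq> 0" "\<And>k. \<gamma> k > 0"
  shows "F B h \<gamma> \<subseteq> dual_feasible B h \<gamma>"
  using dual_feasible_iff_le_interference[where h = h and \<gamma> = \<gamma>, OF assms] by (auto simp: F_def F1_def)

text \<open>Each component of the maximum comes from one of the two points, and its constraint
  survives because \<open>C_mat\<close> grows with \<open>\<beta>\<close>.\<close>

lemma dual_feasible_max:
  assumes B: "hermitian B" and \<beta>: "\<beta> \<in> dual_feasible B h \<gamma>" "\<beta>' \<in> dual_feasible B h \<gamma>"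
  shows "(\<chi> k. max (\<beta> $ k) (\<beta>' $ k)) \<in> dual_feasible B h \<gamma>" (is "?m \<in> _")
proof -
  have le: "\<beta> \<le> ?m" "\<beta>' \<le> ?m" by (simp_all add: less_eq_vec_def)
  have "?m $ k * (\<gamma> k + 1) / \<gamma> k * (cmod (cinner (h k) x))\<^sup>2 \<le> quad (C_mat B h ?m) x" for k x
  proof (cases "\<beta> $ k \<le> \<beta>' $ k")
    case True
    then have "?m $ k = \<beta>' $ k" by simp
    moreover have "\<beta>' $ k * (\<gamma> k + 1) / \<gamma> k * (cmod (cinner (h k) x))\<^sup>2 \<le> quad (C_mat B h \<beta>') x"
      using \<beta>(2) by (simp add: dual_feasible_iff[OF B])
    ultimately show ?thesis
      using quad_C_mat_mono[OF le(2), of B h x] by simp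
  next
    case False
    then have "?m $ k = \<beta> $ k" by simp
    moreover have "\<beta> $ k * (\<gamma> k + 1) / \<gamma> k * (cmod (cinner (h k) x))\<^sup>2 \<le> quad (C_mat B h \<beta>) x"
      using \<beta>(1) by (simp add: dual_feasible_iff[OF B])
    ultimately show ?thesis
      using quad_C_mat_mono[OF le(1), of B h x] by simp
  qed
  moreover have "0 \<le> ?m"
    using \<beta>(1) le(1) unfolding dual_feasible_iff[OF B] by (auto intro: order_trans)
  ultimately show ?thesis unfolding dual_feasible_iff[OF B] by blast
qed

text \<open>Weak duality against the feasible \<open>V\<close> bounds the weighted sum; with
  nonnegative terms and positive weights this bounds every component.\<close>

lemma compact_dual_feasible:
  assumes B: "hermitian B" and \<gamma>: "\<And>k. \<gamma> k > 0" and s2: "\<And>k. s2 k > 0"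
    and V: "V \<in> gdb_feasible h \<gamma> s2"
  shows "compact (dual_feasible B h \<gamma>)"
proof -
  have eq: "dual_feasible B h \<gamma> = {\<beta>. \<forall>k. 0 \<le> \<beta> $ k} \<inter> (\<Inter>k. \<Inter>x.
      {\<beta>. \<beta> $ k * (\<gamma> k + 1) / \<gamma> k * (cmod (cinner (h k) x))\<^sup>2 \<le> quad (C_mat B h \<beta>) x})"
    using dual_feasible_iff[OF B] by (auto simp: less_eq_vec_def)
  have "closed (dual_feasible B h \<gamma>)"
    unfolding eq quad_C_mat divide_inverse
    by (intro closed_Int closed_INT ballI closed_Collect_all closed_Collect_le continuous_intros)
  moreover have "dual_feasible B h \<gamma> \<subseteq> cbox 0 (\<chi> k. gdb_objective B V / s2 k)"
  proof
    fix \<beta> assume \<beta>: "\<beta> \<in> dual_feasible B h \<gamma>"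
    then have pos: "0 \<le> \<beta> $ k" for k
      by (simp add: dual_feasible_iff[OF B] less_eq_vec_def)
    have "\<beta> $ k * s2 k \<le> gdb_objective B V" for k
    proof -
      have "\<beta> $ k * s2 k \<le> (\<Sum>k\<in>UNIV. \<beta> $ k * s2 k)"
        using pos s2 by (intro member_le_sum) (auto simp: less_imp_le)
      with weak_duality[OF B \<gamma> \<beta> V] show ?thesis by simp
    qed
    then show "\<beta> \<in> cbox 0 (\<chi> k. gdb_objective B V / s2 k)"
      using pos s2 by (simp add: mem_box_cart field_simps)
  qed
  then have "bounded (dual_feasible B h \<gamma>)"
    by (rule bounded_subset[OF bounded_cbox])
  ultimately show ?thesis by (simp add: compact_eq_bounded_closed)
qed

text \<open>A maximiser dominates every feasible point, since otherwise the componentwise maximum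
  would be feasible with a larger objective.\<close>

lemma dual_feasible_greatest:
  assumes B: "hermitian B" and \<gamma>: "\<And>k. \<gamma> k > 0" and s2: "\<And>k. s2 k > 0"
    and V: "V \<in> gdb_feasible h \<gamma> s2" and ne: "dual_feasible B h \<gamma> \<noteq> {}"
  obtains b where "b \<in> dual_feasible B h \<gamma>" "\<And>\<beta>. \<beta> \<in> dual_feasible B h \<gamma> \<Longrightarrow> \<beta> \<le> b"
proof -
  let ?f = "\<lambda>\<beta>. \<Sum>k\<in>UNIV. \<beta> $ k * s2 k"
  have "continuous_on (dual_feasible B h \<gamma>) ?f" by (intro continuous_intros)
  then obtain b where b: "b \<in> dual_feasible B h \<gamma>" "\<And>\<beta>. \<beta> \<in> dual_feasible B h \<gamma> \<Longrightarrow> ?f \<beta> \<le> ?f b"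
    using continuous_attains_sup[OF compact_dual_feasible[OF B \<gamma> s2 V] ne] by blast
  have "\<beta> \<le> b" if \<beta>: "\<beta> \<in> dual_feasible B h \<gamma>" for \<beta>
  proof (rule ccontr)
    assume "\<not> \<beta> \<le> b"
    then obtain k where k: "b $ k < \<beta> $ k" by (auto simp: less_eq_vec_def not_le)
    let ?m = "\<chi> k. max (b $ k) (\<beta> $ k)"
    have "?f b < ?f ?m"
      using s2 k by (intro sum_strict_mono_ex1 ballI bexI[of _ k]) (auto simp: less_imp_le)
    with b(2)[OF dual_feasible_max[OF B b(1) \<beta>]] show False by simp
  qed
  with b(1) show ?thesis by (rule that)
qed

lemma dual_optimal_iff_greatest:
  assumes b: "b \<in> dual_feasible B h \<gamma>" "\<And>\<beta>. \<beta> \<in> dual_feasible B h \<gamma> \<Longrightarrow> \<beta> \<le> b"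
    and s2: "\<And>k. s2 k > 0"
  shows "dual_optimal B h \<gamma> s2 \<beta> \<longleftrightarrow> \<beta> = b"
proof -
  let ?f = "\<lambda>\<beta>. \<Sum>k\<in>UNIV. \<beta> $ k * s2 k"
  have le: "?f \<beta> \<le> ?f b" if "\<beta> \<in> dual_feasible B h \<gamma>" for \<beta>
    using b(2)[OF that] s2 by (intro sum_mono mult_right_mono) (auto simp: less_eq_vec_def less_imp_le)
  have less: "?f \<beta> < ?f b" if \<beta>: "\<beta> \<in> dual_feasible B h \<gamma>" "\<beta> \<noteq> b" for \<beta>
  proof -
    obtain k where "\<beta> $ k < b $ k"
      using b(2)[OF \<beta>(1)] \<beta>(2) by (auto simp: less_eq_vec_def vec_eq_iff order_less_le)
    then show ?thesis
      using b(2)[OF \<beta>(1)] s2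
      by (intro sum_strict_mono_ex1 ballI bexI[of _ k])
        (auto simp: less_eq_vec_def less_imp_le intro!: mult_right_mono)
  qed
  show ?thesis
  proof
    assume "dual_optimal B h \<gamma> s2 \<beta>"
    then have "\<beta> \<in> dual_feasible B h \<gamma>" "\<not> ?f \<beta> < ?f b"
      using b(1) by (auto simp: dual_optimal_def is_arg_max_def)
    then show "\<beta> = b" using less by blast
  next
    assume "\<beta> = b"
    then show "dual_optimal B h \<gamma> s2 \<beta>"
      using b(1) le by (auto simp: dual_optimal_def is_arg_max_def not_less)
  qed
qed

text \<open>The values \<open>interference B h \<gamma> b $ k\<close> satisfy the constraints with
  \<open>C_mat B h b\<close>, and passing to the image only enlarges \<open>C_mat\<close> because
  \<open>b\<close> lies below it.\<close>

lemma dual_feasible_interference: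
  assumes B: "hermitian B" and h: "\<And>k. h k \<noteq> 0" and \<gamma>: "\<And>k. \<gamma> k > 0"
    and b: "b \<in> dual_feasible B h \<gamma>"
  shows "interference B h \<gamma> b \<in> dual_feasible B h \<gamma>"
proof -
  have psd: "psd (C_mat B h b)" and le: "b \<le> interference B h \<gamma> b"
    using b by (simp_all add: dual_feasible_iff_le_interference[where h = h and \<gamma> = \<gamma>, OF B h \<gamma>])
  have nonneg: "0 \<le> interference B h \<gamma> b" by (rule interference_nonneg[OF psd h \<gamma>])
  have "interference B h \<gamma> b $ k * (\<gamma> k + 1) / \<gamma> k * (cmod (cinner (h k) x))\<^sup>2
      \<le> quad (C_mat B h b) x" for k x
    using le_interference_iff[where k = k and \<gamma> = \<gamma>, OF psd h \<gamma>, of "interference B h \<gamma> b $ k"] nonneg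
    by (simp add: less_eq_vec_def)
  then show ?thesis
    using nonneg quad_C_mat_mono[OF le] unfolding dual_feasible_iff[OF B] by (meson order_trans)
qed

lemma dual_feasible_of_gdb_bounded:
  fixes h :: "'k::finite \<Rightarrow> complex ^ 'm"
  assumes B: "hermitian B" and \<gamma>: "\<And>k. \<gamma> k > 0" and s2: "\<And>k. s2 k > 0"
    and V0: "V0 \<in> gdb_feasible h \<gamma> s2" and bounded: "gdb_bounded B h \<gamma> s2"
  shows "dual_feasible B h \<gamma> \<noteq> {}"
proof -
  \<comment> \<open>Primal feasibility of positive semidefinite \<open>V\<close> reads
    \<open>s2 k \<le> g V k\<close>, with \<open>g\<close> linear in \<open>V\<close>.\<close>
  define g where "g V k = (1 + 1 / \<gamma> k) * quad (V k) (h k) - (\<Sum>j\<in>UNIV. quad (V j) (h k))"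
    for V k
  \<comment> \<open>The slack allowed in \<open>u\<close> and \<open>t\<close> later fixes the signs
    of the multipliers.\<close>
  define S where "S = {(u, t). \<exists>V. (\<forall>k. psd (V k)) \<and> (\<forall>k. u $ k \<le> g V k) \<and> gdb_objective B V \<le> t}"
  have g_lin: "g (\<lambda>k. r *\<^sub>R V k + r' *\<^sub>R V' k) k = r * g V k + r' * g V' k" for r r' V V' k
    by (simp add: g_def algebra_simps sum.distrib sum_distrib_left)
  have obj_lin: "gdb_objective B (\<lambda>k. r *\<^sub>R V k + r' *\<^sub>R V' k)
      = r * gdb_objective B V + r' * gdb_objective B V'" for r r' and V V' :: "'k \<Rightarrow> complex ^ 'm ^ 'm"
    by (simp add: gdb_objective_sum matrix_mult_simps trace_simps sum.distrib sum_distrib_left)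
  have cone: "r *\<^sub>R p + r' *\<^sub>R p' \<in> S" if pS: "p \<in> S" "p' \<in> S" and r: "0 \<le> r" "0 \<le> r'" for r r' p p'
  proof -
    obtain u t V where p: "p = (u, t)" "\<And>k. psd (V k)" "\<And>k. u $ k \<le> g V k" "gdb_objective B V \<le> t"
      using pS(1) by (auto simp: S_def)
    obtain u' t' V' where p': "p' = (u', t')" "\<And>k. psd (V' k)" "\<And>k. u' $ k \<le> g V' k"
        "gdb_objective B V' \<le> t'"
      using pS(2) by (auto simp: S_def)
    let ?V = "\<lambda>k. r *\<^sub>R V k + r' *\<^sub>R V' k"
    have "psd (?V k)" for k using p p' r by (intro psd_add psd_scaleR)
    moreover have "r * u $ k + r' * u' $ k \<le> g ?V k" for k
      unfolding g_lin using p p' r by (intro add_mono mult_left_mono)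
    moreover have "gdb_objective B ?V \<le> r * t + r' * t'"
      unfolding obj_lin using p p' r by (intro add_mono mult_left_mono)
    ultimately show ?thesis
      unfolding p(1) p'(1) S_def by (auto intro!: exI[of _ ?V])
  qed
  have mem: "((\<chi> k. g V k), gdb_objective B V) \<in> S" if "\<And>k. psd (V k)" for V
    using that by (auto simp: S_def)
  have down: "(u, t) \<in> S" if "\<And>k. u $ k \<le> 0" "0 \<le> t" for u t
  proof -
    have "g (\<lambda>_. 0) k = 0" for k by (simp add: g_def)
    moreover have "gdb_objective B (\<lambda>_ :: 'k. 0) = 0"
      by (simp add: gdb_objective_sum matrix_mult_simps trace_simps)
    ultimately show ?thesis
      using that psd_zero by (auto simp: S_def intro!: exI[of _ "\<lambda>_. 0"])
  qed
  obtain L where L: "\<And>V. V \<in> gdb_feasible h \<gamma> s2 \<Longrightarrow> L \<le> gdb_objective B V"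
    using bounded by (auto simp: gdb_bounded_def bdd_below_def)
  have "((\<chi> k. s2 k), L - 1) \<notin> S"
  proof
    assume "((\<chi> k. s2 k), L - 1) \<in> S"
    then obtain V where "\<forall>k. psd (V k)" "\<forall>k. s2 k \<le> g V k" "gdb_objective B V \<le> L - 1"
      by (auto simp: S_def)
    with L[of V] show False
      by (force simp: gdb_feasible_iff g_def algebra_simps)
  qed
  moreover have "convex S"
    using cone by (simp add: convex_def)
  moreover have "S \<noteq> {}" using mem[of "\<lambda>_. 0"] psd_zero by blast
  ultimately obtain a b where a: "a \<noteq> 0" and b: "\<And>p. p \<in> S \<Longrightarrow> b \<le> a \<bullet> p"
    using separating_hyperplane_sets[of "{((\<chi> k. s2 k), L - 1)}" S] by auto
  have nonneg: "0 \<le> a \<bullet> p" if "p \<in> S" for p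
  proof (rule ccontr)
    assume neg: "\<not> 0 \<le> a \<bullet> p"
    \<comment> \<open>Scaling \<open>p\<close> by \<open>r\<close> would bring the functional to
      \<open>- (\<bar>b\<bar> + 1)\<close>, below its bound \<open>b\<close>.\<close>
    define r where "r = (\<bar>b\<bar> + 1) / - (a \<bullet> p)"
    have "0 \<le> r" unfolding r_def using neg by (intro divide_nonneg_nonneg) auto
    then have "r *\<^sub>R p + 0 *\<^sub>R p \<in> S" by (rule cone[OF that that]) simp
    from b[OF this] have "b \<le> a \<bullet> (r *\<^sub>R p)" by simp
    also have "a \<bullet> (r *\<^sub>R p) = - (\<bar>b\<bar> + 1)" using neg by (simp add: r_def)
    finally show False by simp
  qed
  obtain a1 a2 where a12: "a = (a1, a2)" by (cases a)
  have S_ineq: "0 \<le> (\<Sum>k\<in>UNIV. a1 $ k * u $ k) + a2 * t" if "(u, t) \<in> S" for u t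
    using nonneg[OF that] by (simp add: a12 inner_vec_def)
  have a1: "a1 $ k \<le> 0" for k
    using S_ineq[OF down, of "- axis k 1" 0]
    by (simp add: axis_def if_distrib sum_negf cong: if_cong)
  have "0 \<le> a2"
    using S_ineq[OF down, of 0 1] by simp
  \<comment> \<open>The point \<open>V0\<close> plays the role of a Slater point: with
    \<open>a2 = 0\<close>, nonpositive multipliers against positive \<open>g V0 k\<close> must all
    vanish, contradicting \<open>a \<noteq> 0\<close>.\<close>
  moreover have "a2 \<noteq> 0"
  proof
    assume "a2 = 0"
    have gV0: "s2 k \<le> g V0 k" for k using V0 by (simp add: gdb_feasible_iff g_def algebra_simps)
    have gpos: "0 < g V0 k" for k using gV0[of k] s2[of k] by simp
    have "0 \<le> (\<Sum>k\<in>UNIV. a1 $ k * g V0 k)"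
      using S_ineq[OF mem[of V0]] V0 \<open>a2 = 0\<close> by (simp add: gdb_feasible_iff)
    then have "(\<Sum>k\<in>UNIV. - (a1 $ k * g V0 k)) \<le> 0" by (simp add: sum_negf)
    moreover have nonneg_term: "0 \<le> - (a1 $ k * g V0 k)" for k
      using a1[of k] gpos[of k] by (simp add: mult_nonpos_nonneg)
    ultimately have "(\<Sum>k\<in>UNIV. - (a1 $ k * g V0 k)) = 0"
      by (intro antisym sum_nonneg)
    then have "- (a1 $ k * g V0 k) = 0" for k
      using nonneg_term by (subst (asm) sum_nonneg_eq_0_iff) auto
    then have "a1 $ k = 0" for k using gpos[of k] by (metis mult_eq_0_iff neg_equal_0_iff_equal order_less_irrefl)
    with a \<open>a2 = 0\<close> show False by (simp add: a12 vec_eq_iff zero_prod_def)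
  qed
  ultimately have a2: "0 < a2" by simp
  define \<beta> where "\<beta> = (\<chi> k. - a1 $ k / a2)"
  have "\<beta> $ k * (\<gamma> k + 1) / \<gamma> k * (cmod (cinner (h k) x))\<^sup>2 \<le> quad (C_mat B h \<beta>) x" for k x
  proof -
    \<comment> \<open>A rank-one matrix in slot \<open>k\<close> alone makes the separating
      inequality exactly dual constraint \<open>k\<close> at \<open>x\<close>, up to the factor
      \<open>a2\<close>.\<close>
    define V where "V j = (if j = k then outer x else 0)" for j
    have qV: "quad (V j) y = (if j = k then (cmod (cinner x y))\<^sup>2 else 0)" for j y
      by (simp add: V_def)
    have gV: "g V i = (if i = k then (1 + 1 / \<gamma> k) * (cmod (cinner (h k) x))\<^sup>2 else 0)
        - (cmod (cinner (h i) x))\<^sup>2" for i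
      by (simp add: g_def qV cmod_cinner_commute[of x])
    have "gdb_objective B V = (\<Sum>j\<in>UNIV. if j = k then quad B x else 0)"
      unfolding gdb_objective_sum
      by (intro sum.cong) (auto simp: V_def trace_mult_outer quad_def matrix_mult_simps trace_simps)
    then have obj: "gdb_objective B V = quad B x" by simp
    have "psd (V j)" for j by (simp add: V_def psd_outer psd_zero)
    from S_ineq[OF mem[of V, OF this]]
    have "0 \<le> (\<Sum>i\<in>UNIV. a1 $ i * g V i) + a2 * quad B x"
      by (simp add: obj)
    also have "(\<Sum>i\<in>UNIV. a1 $ i * g V i)
        = a1 $ k * ((1 + 1 / \<gamma> k) * (cmod (cinner (h k) x))\<^sup>2)
          - (\<Sum>i\<in>UNIV. a1 $ i * (cmod (cinner (h i) x))\<^sup>2)"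
    proof -
      have "(\<Sum>i\<in>UNIV. a1 $ i * g V i)
          = (\<Sum>i\<in>UNIV. (if i = k then a1 $ k * ((1 + 1 / \<gamma> k) * (cmod (cinner (h k) x))\<^sup>2) else 0)
              - a1 $ i * (cmod (cinner (h i) x))\<^sup>2)"
        by (intro sum.cong) (auto simp: gV right_diff_distrib)
      then show ?thesis by (simp add: sum_subtractf)
    qed
    finally have *: "0 \<le> (a1 $ k * ((1 + 1 / \<gamma> k) * (cmod (cinner (h k) x))\<^sup>2)
          - (\<Sum>i\<in>UNIV. a1 $ i * (cmod (cinner (h i) x))\<^sup>2) + a2 * quad B x) / a2"
      using a2 by simp
    have "quad (C_mat B h \<beta>) x = quad B x - (\<Sum>i\<in>UNIV. a1 $ i * (cmod (cinner (h i) x))\<^sup>2) / a2"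
      by (simp add: quad_C_mat \<beta>_def sum_divide_distrib sum_negf)
    moreover have "\<beta> $ k * (\<gamma> k + 1) / \<gamma> k * (cmod (cinner (h k) x))\<^sup>2
        = - (a1 $ k * ((1 + 1 / \<gamma> k) * (cmod (cinner (h k) x))\<^sup>2) / a2)"
      using \<gamma>[of k] a2 by (simp add: \<beta>_def field_simps)
    ultimately show ?thesis
      using * a2 by (simp add: add_divide_distrib diff_divide_distrib)
  qed
  moreover have "0 \<le> \<beta>"
    using a1 a2 by (simp add: \<beta>_def less_eq_vec_def divide_nonpos_pos)
  ultimately show ?thesis
    using dual_feasible_iff[OF B] by blast
qed

text \<open>Primal feasibility gives nonzero channels and a compact dual feasible set. The last
  equivalence assumes that dual optima lie in \<open>F1\<close>: for \<open>B = 0\<close> with one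
  antenna and one user the primal is bounded, but the dual optimum 0 is outside \<open>F1\<close>,
  and \<open>F1\<close> contains no fixed point.\<close>

theorem proposition1:
  fixes B :: "complex ^ 'm ^ 'm"
    and h :: "'k::finite \<Rightarrow> complex ^ 'm"
    and \<gamma> s2 :: "'k \<Rightarrow> real"
  assumes B: "hermitian B"
    and \<gamma>: "\<And>k. \<gamma> k > 0"
    and s2: "\<And>k. s2 k > 0"
    and gdb_feasible: "gdb_feasible h \<gamma> s2 \<noteq> {}"
  shows
    "(dual_feasible B h \<gamma> \<noteq> {} \<longrightarrow>
        (\<exists>!\<beta>s. dual_optimal B h \<gamma> s2 \<beta>s) \<and>
        (\<forall>\<beta>s. dual_optimal B h \<gamma> s2 \<beta>s \<longrightarrow> (\<forall>\<beta>\<in>F B h \<gamma>. \<beta> \<le> \<beta>s))) \<and>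
     (\<forall>\<beta>s. dual_optimal B h \<gamma> s2 \<beta>s \<longrightarrow> \<beta>s = interference B h \<gamma> \<beta>s) \<and>
     ((\<forall>\<beta>s. dual_optimal B h \<gamma> s2 \<beta>s \<longrightarrow> \<beta>s \<in> F1 B h) \<longrightarrow>
        (gdb_bounded B h \<gamma> s2 \<longleftrightarrow> (\<exists>\<beta>\<in>F1 B h. \<beta> = interference B h \<gamma> \<beta>)))"
proof -
  obtain V0 where V0: "V0 \<in> gdb_feasible h \<gamma> s2" using gdb_feasible by blast
  have h: "h k \<noteq> 0" for k by (rule gdb_feasible_channel_nonzero[OF V0 s2])
  have greatest: "\<exists>b. b \<in> dual_feasible B h \<gamma> \<and> (\<forall>\<beta>\<in>dual_feasible B h \<gamma>. \<beta> \<le> b) \<and>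
      b = interference B h \<gamma> b \<and> (\<forall>\<beta>. dual_optimal B h \<gamma> s2 \<beta> \<longleftrightarrow> \<beta> = b)"
    if ne: "dual_feasible B h \<gamma> \<noteq> {}"
  proof -
    obtain b where b: "b \<in> dual_feasible B h \<gamma>" "\<And>\<beta>. \<beta> \<in> dual_feasible B h \<gamma> \<Longrightarrow> \<beta> \<le> b"
      using dual_feasible_greatest[OF B \<gamma> s2 V0 ne] by blast
    have "b = interference B h \<gamma> b"
    proof (rule antisym)
      show "b \<le> interference B h \<gamma> b"
        using b(1) dual_feasible_iff_le_interference[where h = h and \<gamma> = \<gamma>, OF B h \<gamma>] by blast
      show "interference B h \<gamma> b \<le> b"
        by (rule b(2)[OF dual_feasible_interference[where h = h and \<gamma> = \<gamma>, OF B h \<gamma> b(1)]])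
    qed
    moreover have "dual_optimal B h \<gamma> s2 \<beta> \<longleftrightarrow> \<beta> = b" for \<beta>
      using b s2 by (rule dual_optimal_iff_greatest)
    ultimately show ?thesis
      using b by (intro exI[of _ b] conjI ballI allI)
  qed
  have "(\<exists>!\<beta>s. dual_optimal B h \<gamma> s2 \<beta>s) \<and>
      (\<forall>\<beta>s. dual_optimal B h \<gamma> s2 \<beta>s \<longrightarrow> (\<forall>\<beta>\<in>F B h \<gamma>. \<beta> \<le> \<beta>s))"
    if "dual_feasible B h \<gamma> \<noteq> {}"
    using greatest[OF that] F_subset_dual_feasible[where h = h and \<gamma> = \<gamma>, OF B h \<gamma>] by auto
  moreover have fixed: "\<beta>s = interference B h \<gamma> \<beta>s" if opt: "dual_optimal B h \<gamma> s2 \<beta>s" for \<beta>s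
  proof -
    have "dual_feasible B h \<gamma> \<noteq> {}"
      using opt by (auto simp: dual_optimal_def is_arg_max_def)
    from greatest[OF this] opt show ?thesis by auto
  qed
  moreover have "gdb_bounded B h \<gamma> s2 \<longleftrightarrow> (\<exists>\<beta>\<in>F1 B h. \<beta> = interference B h \<gamma> \<beta>)"
    if F1: "\<And>\<beta>s. dual_optimal B h \<gamma> s2 \<beta>s \<Longrightarrow> \<beta>s \<in> F1 B h"
  proof
    assume "gdb_bounded B h \<gamma> s2"
    from greatest[OF dual_feasible_of_gdb_bounded[OF B \<gamma> s2 V0 this]]
    obtain b where "dual_optimal B h \<gamma> s2 b" by blast
    with F1 fixed show "\<exists>\<beta>\<in>F1 B h. \<beta> = interference B h \<gamma> \<beta>" by blast
  next
    assume "\<exists>\<beta>\<in>F1 B h. \<beta> = interference B h \<gamma> \<beta>"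
    then obtain \<beta> where \<beta>: "\<beta> \<in> F1 B h" "\<beta> = interference B h \<gamma> \<beta>" by blast
    \<comment> \<open>A fixed point in \<open>F1\<close> is dual feasible, so its dual value bounds
      the primal from below.\<close>
    then have "\<beta> \<in> F B h \<gamma>" using eq_refl[OF \<beta>(2)] by (simp add: F_def)
    then have "\<beta> \<in> dual_feasible B h \<gamma>"
      using F_subset_dual_feasible[where h = h and \<gamma> = \<gamma>, OF B h \<gamma>] by blast
    then show "gdb_bounded B h \<gamma> s2"
      unfolding gdb_bounded_def by (intro bdd_belowI2) (rule weak_duality[OF B \<gamma>])
  qed
  ultimately show ?thesis by blast
qed

end
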